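(* $\hat{A}(n) = \Theta(n)$ as $n\to\infty$.
   Context: For a finite set $\mathcal P \subset \mathbb{R}^2$ and $p \in \mathcal P$, $A_p(\mathcal P)$ denotes the number of distinct values in $(0,\pi)$ of angles $\angle q p r$ with center (vertex) $p$ and $q,r \in \mathcal P\setminus\{p\}$ distinct. Define $$\hat{A}(n) := \min_{|\mathcal{P}| = n}\ \max_{p \in \mathcal P} A_p(\mathcal{P}),$$ where the minimum is over all sets $\mathcal{P}\subset\mathbb{R}^2$ of $n$ points that are not all collinear. $f = O(g)$ means there is a constant $C$ with $f(n) \le C g(n)$ for all sufficiently large $n$; $f=\Theta(g)$ means $f = O(g)$ and $g = O(f)$. *)

theory Defs
  imports "HOL-Analysis.Analysis" "HOL-Library.Landau_Symbols"
begin

definition angle_at :: "real ^ 2 \<Rightarrow> real ^ 2 \<Rightarrow> real ^ 2 \<Rightarrow> real" where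
  \<comment> \<open>the unsigned angle \<open>q p r\<close> with vertex \<open>p\<close>, in \<open>[0, pi]\<close>; meaningful for \<open>q \<noteq> p\<close> and \<open>r \<noteq> p\<close>\<close>
  "angle_at q p r = arccos (((q - p) \<bullet> (r - p)) / (norm (q - p) * norm (r - p)))"

definition angle_count :: "(real ^ 2) set \<Rightarrow> real ^ 2 \<Rightarrow> nat" where
  "angle_count P p =
     card ({angle_at q p r | q r. q \<in> P - {p} \<and> r \<in> P - {p} \<and> q \<noteq> r} \<inter> {0<..<pi})"

definition max_angle_count :: "(real ^ 2) set \<Rightarrow> nat" where
  "max_angle_count P = Max (angle_count P ` P)"

definition admissible :: "nat \<Rightarrow> (real ^ 2) set \<Rightarrow> bool" where
  "admissible n P \<longleftrightarrow> finite P \<and> card P = n \<and> \<not> collinear P"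

definition A_hat :: "nat \<Rightarrow> nat" where
  \<comment> \<open>an infimum of natural numbers, hence a minimum as soon as an admissible set exists,
    i.e. for \<open>n \<ge> 3\<close>; see \<open>A_hat_attained\<close> and \<open>A_hat_le\<close>\<close>
  "A_hat n = Inf {max_angle_count P | P. admissible n P}"

lemma admissible_exists:
  assumes "n \<ge> 3"
  shows "\<exists>P. admissible n P"
proof -
  define a where "a = (vector [1, 0] :: real ^ 2)"
  define b where "b = (vector [0, 1] :: real ^ 2)"
  have ab: "a \<noteq> 0" "b \<noteq> 0" "a \<noteq> b" "\<And>c. b \<noteq> c *\<^sub>R a"
    by (auto simp: a_def b_def vec_eq_iff forall_2)
  have nc: "\<not> collinear {0, a, b}"
    using ab by (auto simp: collinear_lemma)
  have "infinite (UNIV - {0, a, b})"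
    by (intro Diff_infinite_finite infinite_UNIV_vec infinite_UNIV_char_0) auto
  then obtain B where B: "finite B" "card B = n - 3" "B \<subseteq> UNIV - {0, a, b}"
    using infinite_arbitrarily_large by blast
  have "card ({0, a, b} \<union> B) = n"
    using B ab assms by (subst card_Un_disjoint) auto
  moreover have "\<not> collinear ({0, a, b} \<union> B)"
    using nc collinear_subset by blast
  ultimately show ?thesis
    using B(1) by (auto simp: admissible_def intro!: exI[of _ "{0, a, b} \<union> B"])
qed

lemma A_hat_attained:
  assumes "n \<ge> 3"
  shows "\<exists>P. admissible n P \<and> A_hat n = max_angle_count P"
proof -
  have "{max_angle_count P | P. admissible n P} \<noteq> {}"
    using admissible_exists[OF assms] by blast
  from Inf_nat_def1[OF this] show ?thesis
    unfolding A_hat_def by blast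
qed

lemma A_hat_le: "admissible n P \<Longrightarrow> A_hat n \<le> max_angle_count P"
  unfolding A_hat_def by (rule cInf_lower) auto

end

theory Submission
  imports Defs
begin

text \<open>
  Lower bound: suppose no line contains a positive fraction of the points (otherwise a point off
  that line sees many directions). A median line together with a line bisecting both of its sides
  cuts off four parts of equal size \<open>m \<approx> n / 8\<close>, and a line meets at most three of them. Hence a line
  with \<open>s\<close> points, \<open>s\<^sub>i\<close> of them in part \<open>i\<close>, satisfies \<open>s\<^sup>2 \<le> 3 (\<Sum> s\<^sub>i\<^sup>2)\<close>. Summing over all lines and
  counting collinear pairs on both sides leaves \<open>4 m\<^sup>2 \<le> 2 I\<close> for the number \<open>I\<close> of incidences, so one
  of the \<open>4 m\<close> points lies on at least \<open>m / 2\<close> lines.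
  Finally, \<open>d\<close> directions at a point give at least \<open>(d - 1) / 2\<close> angles, since seen from a fixed one of
  them each angle value occurs at most once on either side.

  Upper bound: take collinear points that are seen from the origin under equally spaced directions,
  together with the origin.
\<close>

section \<open>Blocks through pairs of points\<close>

text \<open>Double counting of triples \<open>(l, p, q)\<close> with \<open>p\<close>,
  \<open>q\<close> in \<open>l \<inter> C\<close>. A pair with \<open>p \<noteq> q\<close> lies in
  exactly one block, while \<open>p = q\<close> contributes the degree of \<open>p\<close>. Adding
  \<open>card C\<close> on the left avoids subtraction on \<open>nat\<close>.\<close>

lemma sum_squares_card_inter_blocks:
  fixes L :: "'a set set"
  assumes L: "finite L" and C: "finite C"
    and pair: "\<And>p q. p \<in> C \<Longrightarrow> q \<in> C \<Longrightarrow> p \<noteq> q \<Longrightarrow> card {l \<in> L. p \<in> l \<and> q \<in> l} = 1"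
  shows "(\<Sum>l\<in>L. (card (l \<inter> C))\<^sup>2) + card C = (card C)\<^sup>2 + (\<Sum>p\<in>C. card {l \<in> L. p \<in> l})"
proof -
  have card_filter: "card {x \<in> A. R x} = (\<Sum>x\<in>A. if R x then 1 else 0)" if "finite A"
    for A :: "'b set" and R
    using that by (simp add: sum.If_cases Int_def)
  have "(card (l \<inter> C))\<^sup>2 = (\<Sum>p\<in>C. \<Sum>q\<in>C. if p \<in> l \<and> q \<in> l then 1 else 0)" for l
  proof -
    have "card (l \<inter> C) = (\<Sum>p\<in>C. if p \<in> l then 1 else 0)"
      using card_filter[OF C, of "\<lambda>p. p \<in> l"] by (simp add: Int_def conj_commute)
    then show ?thesis
      by (auto simp: power2_eq_square sum_product intro!: sum.cong)
  qed
  then have "(\<Sum>l\<in>L. (card (l \<inter> C))\<^sup>2) =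
      (\<Sum>l\<in>L. \<Sum>p\<in>C. \<Sum>q\<in>C. if p \<in> l \<and> q \<in> l then 1 else 0)"
    by simp
  also have "\<dots> = (\<Sum>p\<in>C. \<Sum>l\<in>L. \<Sum>q\<in>C. if p \<in> l \<and> q \<in> l then 1 else 0)"
    by (rule sum.swap)
  also have "\<dots> = (\<Sum>p\<in>C. \<Sum>q\<in>C. \<Sum>l\<in>L. if p \<in> l \<and> q \<in> l then 1 else 0)"
    by (intro sum.cong refl sum.swap)
  also have "\<dots> = (\<Sum>p\<in>C. \<Sum>q\<in>C. card {l \<in> L. p \<in> l \<and> q \<in> l})"
    using card_filter[OF L] by simp
  also have "\<dots> = (\<Sum>p\<in>C. card {l \<in> L. p \<in> l} + (card C - 1))"
  proof (rule sum.cong[OF refl])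
    fix p assume p: "p \<in> C"
    have "(\<Sum>q\<in>C. card {l \<in> L. p \<in> l \<and> q \<in> l}) =
        card {l \<in> L. p \<in> l} + (\<Sum>q\<in>C - {p}. card {l \<in> L. p \<in> l \<and> q \<in> l})"
      using sum.remove[OF C p, of "\<lambda>q. card {l \<in> L. p \<in> l \<and> q \<in> l}"] by simp
    also have "(\<Sum>q\<in>C - {p}. card {l \<in> L. p \<in> l \<and> q \<in> l}) = (\<Sum>q\<in>C - {p}. 1)"
      using pair p by (intro sum.cong) auto
    also have "\<dots> = card C - 1"
      using p C by simp
    finally show "(\<Sum>q\<in>C. card {l \<in> L. p \<in> l \<and> q \<in> l}) = card {l \<in> L. p \<in> l} + (card C - 1)" .
  qed
  also have "\<dots> = (\<Sum>p\<in>C. card {l \<in> L. p \<in> l}) + card C * (card C - 1)"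
    by (simp add: sum.distrib)
  finally show ?thesis
    by (cases "card C") (simp_all add: power2_eq_square)
qed

text \<open>With \<open>k = card I\<close>, a block has points in at most \<open>k - 1\<close>
  parts, so Cauchy-Schwarz bounds the square of its size by \<open>k - 1\<close> times the sum of
  the squares over the parts. Summing over the blocks and evaluating both sides by pair counting
  gives a lower bound on the number \<open>D\<close> of incidences, and one of the
  \<open>k * m\<close> points reaches the average.\<close>

lemma exists_point_in_many_blocks:
  fixes L :: "'a set set" and C :: "'i \<Rightarrow> 'a set"
  assumes I: "finite I" "2 \<le> card I" and disj: "disjoint_family_on C I"
    and C: "\<And>i. i \<in> I \<Longrightarrow> finite (C i)" "\<And>i. i \<in> I \<Longrightarrow> card (C i) = m" and m: "0 < m"
    and L: "finite L" "\<And>l. l \<in> L \<Longrightarrow> l \<subseteq> (\<Union>i\<in>I. C i)"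
    and pair: "\<And>p q. p \<in> (\<Union>i\<in>I. C i) \<Longrightarrow> q \<in> (\<Union>i\<in>I. C i) \<Longrightarrow> p \<noteq> q \<Longrightarrow>
                 card {l \<in> L. p \<in> l \<and> q \<in> l} = 1"
    and miss: "\<And>l. l \<in> L \<Longrightarrow> \<exists>i\<in>I. l \<inter> C i = {}"
  shows "\<exists>p\<in>(\<Union>i\<in>I. C i). m \<le> (card I - 2) * card {l \<in> L. p \<in> l}"
proof (rule ccontr)
  define Q where "Q = (\<Union>i\<in>I. C i)"
  define k where "k = real (card I)"
  define d where "d p = card {l \<in> L. p \<in> l}" for p
  define D where "D = (\<Sum>p\<in>Q. d p)"
  assume "\<not> ?thesis"
  then have small: "(card I - 2) * d p < m" if "p \<in> Q" for p
    using that by (auto simp: Q_def d_def not_le)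
  have finQ: "finite Q"
    using I C by (auto simp: Q_def)
  have sumQ: "sum f Q = (\<Sum>i\<in>I. sum f (C i))" for f :: "'a \<Rightarrow> nat"
    unfolding Q_def using I C disj
    by (intro sum.UNION_disjoint) (auto simp: disjoint_family_on_def)
  have cardQ: "card Q = card I * m"
    using sumQ[of "\<lambda>_. 1"] C by simp
  have Qne: "Q \<noteq> {}"
    using cardQ m I by auto
  have k2: "k \<ge> 2"
    using I by (simp add: k_def)
  have sq: "(real (card l))\<^sup>2 \<le> (k - 1) * (\<Sum>i\<in>I. (real (card (l \<inter> C i)))\<^sup>2)" if l: "l \<in> L" for l
  proof -
    obtain j where j: "j \<in> I" "l \<inter> C j = {}"
      using miss[OF l] by blast
    have "l = (\<Union>i\<in>I. l \<inter> C i)"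
      using L(2)[OF l] by auto
    then have "card l = (\<Sum>i\<in>I. card (l \<inter> C i))"
      using card_UN_disjoint[OF I(1), of "\<lambda>i. l \<inter> C i"] C disj
      by (fastforce simp: disjoint_family_on_def)
    also have "\<dots> = (\<Sum>i\<in>I - {j}. card (l \<inter> C i))"
      using j I sum.remove[of I j "\<lambda>i. card (l \<inter> C i)"] by simp
    finally have "(real (card l))\<^sup>2 = (\<Sum>i\<in>I - {j}. real (card (l \<inter> C i)))\<^sup>2"
      by simp
    \<comment> \<open>Leaving out the missed part \<open>j\<close> is the decisive gain: with factor
      \<open>k\<close> in place of \<open>k - 1\<close> the terms in \<open>m\<^sup>2\<close> would
      cancel and only the trivial \<open>k * m \<le> D\<close> would remain.\<close>
    also have "\<dots> \<le> (\<Sum>i\<in>I - {j}. (real (card (l \<inter> C i)))\<^sup>2) * card (I - {j})"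
      by (rule sum_squared_le_sum_of_squares)
    also have "(\<Sum>i\<in>I - {j}. (real (card (l \<inter> C i)))\<^sup>2) = (\<Sum>i\<in>I. (real (card (l \<inter> C i)))\<^sup>2)"
      using j I sum.remove[of I j "\<lambda>i. (real (card (l \<inter> C i)))\<^sup>2"] by simp
    also have "real (card (I - {j})) = k - 1"
      using j I by (simp add: k_def)
    finally show ?thesis
      by (simp add: mult.commute)
  qed
  have LQ: "l \<inter> Q = l" if "l \<in> L" for l
    using L(2)[OF that] by (auto simp: Q_def)
  have 1: "(\<Sum>l\<in>L. (card l)\<^sup>2) + card Q = (card Q)\<^sup>2 + D"
    using sum_squares_card_inter_blocks[OF L(1) finQ] pair LQ by (simp add: Q_def D_def d_def)
  have 2: "(\<Sum>l\<in>L. (card (l \<inter> C i))\<^sup>2) + m = m\<^sup>2 + (\<Sum>p\<in>C i. d p)" if "i \<in> I" for i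
  proof -
    have "(\<Sum>l\<in>L. (card (l \<inter> C i))\<^sup>2) + card (C i) = (card (C i))\<^sup>2 + (\<Sum>p\<in>C i. card {l \<in> L. p \<in> l})"
      using that pair by (intro sum_squares_card_inter_blocks L C) auto
    then show ?thesis
      using C(2)[OF that] by (simp add: d_def)
  qed
  have 3: "(\<Sum>i\<in>I. \<Sum>l\<in>L. (card (l \<inter> C i))\<^sup>2) + card I * m = card I * m\<^sup>2 + D"
  proof -
    have "(\<Sum>i\<in>I. (\<Sum>l\<in>L. (card (l \<inter> C i))\<^sup>2) + m) = (\<Sum>i\<in>I. m\<^sup>2 + (\<Sum>p\<in>C i. d p))"
      using 2 by simp
    then show ?thesis
      by (simp add: sum.distrib sumQ D_def)
  qed
  have "(\<Sum>l\<in>L. (real (card l))\<^sup>2) \<le> (\<Sum>l\<in>L. (k - 1) * (\<Sum>i\<in>I. (real (card (l \<inter> C i)))\<^sup>2))"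
    by (intro sum_mono sq)
  also have "\<dots> = (k - 1) * (\<Sum>i\<in>I. \<Sum>l\<in>L. (real (card (l \<inter> C i)))\<^sup>2)"
    by (subst sum.swap) (simp add: sum_distrib_left)
  finally have 4: "(\<Sum>l\<in>L. (real (card l))\<^sup>2) \<le> (k - 1) * (\<Sum>i\<in>I. \<Sum>l\<in>L. (real (card (l \<inter> C i)))\<^sup>2)" .
  have 5: "(\<Sum>l\<in>L. (real (card l))\<^sup>2) = (k * m)\<^sup>2 + D - k * m"
    using arg_cong[OF 1, of real] by (simp add: cardQ k_def)
  have 6: "(\<Sum>i\<in>I. \<Sum>l\<in>L. (real (card (l \<inter> C i)))\<^sup>2) = k * m\<^sup>2 + D - k * m"
    using arg_cong[OF 3, of real] by (simp add: k_def)
  \<comment> \<open>Since \<open>(k * m)\<^sup>2 - (k - 1) * k * m\<^sup>2 = k * m\<^sup>2\<close>,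
    this rearranges to \<open>k * m\<^sup>2 + (k - 2) * k * m \<le> (k - 2) * D\<close>.\<close>
  have "(k * m)\<^sup>2 + D - k * m \<le> (k - 1) * (k * m\<^sup>2 + D - k * m)"
    using 4 unfolding 5 6 .
  moreover have "(k - 2) * (k * m) \<ge> 0"
    using k2 by simp
  ultimately have lower: "k * m\<^sup>2 \<le> (k - 2) * D"
    by (simp add: algebra_simps power2_eq_square)
  have "(k - 2) * D = (\<Sum>p\<in>Q. (k - 2) * d p)"
    by (simp add: D_def sum_distrib_left)
  also have "\<dots> < (\<Sum>p\<in>Q. real m)"
  proof (rule sum_strict_mono[OF finQ Qne])
    fix p assume "p \<in> Q"
    then have "real ((card I - 2) * d p) < real m"
      using small by (simp only: of_nat_less_iff)
    then show "(k - 2) * d p < real m"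
      using I by (simp add: k_def of_nat_diff)
  qed
  also have "\<dots> = k * m\<^sup>2"
    by (simp add: cardQ k_def power2_eq_square)
  finally show False
    using lower by simp
qed

section \<open>Bisecting planar point sets\<close>

text \<open>The median is an element of least \<open>f\<close>-value among those with more than half
  of \<open>S\<close> at or below them. The strict inequality on one side later forces a majority
  and a half to intersect.\<close>

lemma median_exists:
  fixes f :: "'a \<Rightarrow> real"
  assumes "finite S" "S \<noteq> {}"
  shows "\<exists>a\<in>S. card S < 2 * card {x \<in> S. f x \<le> f a} \<and> card S \<le> 2 * card {x \<in> S. f a \<le> f x}"
proof -
  define T where "T = {a \<in> S. card S < 2 * card {x \<in> S. f x \<le> f a}}"
  have "finite T"
    using assms by (simp add: T_def)
  obtain b where b: "b \<in> S" "\<And>x. x \<in> S \<Longrightarrow> f x \<le> f b"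
    using ex_is_arg_min_if_finite[OF assms, of "\<lambda>x. - f x"] by (auto simp: is_arg_min_linorder)
  have "card S > 0"
    using assms by (simp add: card_gt_0_iff)
  moreover have "{x \<in> S. f x \<le> f b} = S"
    using b by auto
  ultimately have "b \<in> T"
    using b by (auto simp: T_def)
  then obtain a where a: "a \<in> T" "\<And>x. x \<in> T \<Longrightarrow> f a \<le> f x"
    using ex_is_arg_min_if_finite[of T f] \<open>finite T\<close> by (auto simp: is_arg_min_linorder)
  define B where "B = {x \<in> S. f x < f a}"
  \<comment> \<open>If \<open>B\<close> is nonempty, its topmost element \<open>c\<close> lies
    strictly below the minimal element of \<open>T\<close>, hence outside \<open>T\<close>, and
    \<open>B\<close> is exactly the set of points at or below \<open>c\<close>.\<close>
  have "2 * card B \<le> card S"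
  proof (cases "B = {}")
    case False
    moreover have "finite B"
      using assms by (simp add: B_def)
    ultimately obtain c where c: "c \<in> B" "\<And>x. x \<in> B \<Longrightarrow> f x \<le> f c"
      using ex_is_arg_min_if_finite[of B "\<lambda>x. - f x"] by (auto simp: is_arg_min_linorder)
    have "c \<in> S" "c \<notin> T"
      using c(1) a(2) by (force simp: B_def)+
    moreover have "{x \<in> S. f x \<le> f c} = B"
      using c by (force simp: B_def)
    ultimately show ?thesis
      by (simp add: T_def not_less)
  qed simp
  moreover have "card S = card B + card {x \<in> S. f a \<le> f x}"
    using assms by (subst card_Un_disjoint[symmetric]) (auto simp: B_def intro!: arg_cong[of _ _ card])
  ultimately show ?thesis
    using a(1) by (auto simp: T_def)
qed

lemma inter_nonempty_of_card:
  assumes "finite S" "A \<subseteq> S" "B \<subseteq> S" "card S < card A + card B"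
  shows "A \<inter> B \<noteq> {}"
proof
  assume "A \<inter> B = {}"
  then have "card A + card B = card (A \<union> B)"
    using assms finite_subset by (metis card_Un_disjoint)
  also have "\<dots> \<le> card S"
    using assms by (intro card_mono) auto
  finally show False
    using assms by simp
qed

text \<open>A continuity argument in the slope \<open>t\<close>. The slopes where a median of
  \<open>L\<close> is at most one of \<open>R\<close>, and those with the reverse order, form two
  closed nonempty sets covering the real line. By connectedness they share a slope, and there one
  level bisects both sets.\<close>

lemma ham_sandwich_separated:
  fixes L R :: "(real ^ 2) set"
  assumes L: "finite L" "L \<noteq> {}" "\<And>p. p \<in> L \<Longrightarrow> p $ 1 < c"
    and R: "finite R" "R \<noteq> {}" "\<And>p. p \<in> R \<Longrightarrow> c < p $ 1"
  shows "\<exists>t u. \<forall>S\<in>{L, R}. card S \<le> 2 * card {p \<in> S. p $ 2 - t * p $ 1 \<le> u} \<and>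
                            card S \<le> 2 * card {p \<in> S. u \<le> p $ 2 - t * p $ 1}"
proof -
  define h where "h t p = p $ 2 - t * p $ 1" for t and p :: "real ^ 2"
  \<comment> \<open>Medians are replaced by subsets: for each of the finitely many choices of
    \<open>A\<close> and \<open>B\<close> the condition on \<open>t\<close> is closed. The strict
    majority is required of \<open>L\<close> in \<open>U\<close> and of \<open>R\<close> in
    \<open>V\<close>, so that it meets the corresponding half in the other set.\<close>
  define U where "U = {t. \<exists>A\<in>Pow L. \<exists>B\<in>Pow R. card L < 2 * card A \<and> card R \<le> 2 * card B \<and>
                            (\<forall>p\<in>A. \<forall>q\<in>B. h t p \<le> h t q)}"
  define V where "V = {t. \<exists>A\<in>Pow L. \<exists>B\<in>Pow R. card L \<le> 2 * card A \<and> card R < 2 * card B \<and>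
                            (\<forall>p\<in>A. \<forall>q\<in>B. h t q \<le> h t p)}"
  have *: "closed {t. \<forall>p\<in>A. \<forall>q\<in>B. h t p \<le> h t q}" for A B
    unfolding h_def Ball_def
    by (intro closed_Collect_all closed_Collect_imp open_Collect_const closed_Collect_le continuous_intros)
  have "closed U"
  proof -
    have "U = (\<Union>X \<in> {X \<in> Pow L \<times> Pow R. card L < 2 * card (fst X) \<and> card R \<le> 2 * card (snd X)}.
        {t. \<forall>p\<in>fst X. \<forall>q\<in>snd X. h t p \<le> h t q})"
      unfolding U_def by (rule set_eqI) (simp only: UN_iff mem_Collect_eq Bex_def mem_Times_iff split_paired_Ex fst_conv snd_conv, blast)
    moreover have "finite {X \<in> Pow L \<times> Pow R. card L < 2 * card (fst X) \<and> card R \<le> 2 * card (snd X)}"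
      using L(1) R(1) by simp
    ultimately show ?thesis
      by (simp only:) (rule closed_UN; simp add: *)
  qed
  moreover have "closed V"
  proof -
    have "V = (\<Union>X \<in> {X \<in> Pow L \<times> Pow R. card L \<le> 2 * card (fst X) \<and> card R < 2 * card (snd X)}.
        {t. \<forall>q\<in>snd X. \<forall>p\<in>fst X. h t q \<le> h t p})"
      unfolding V_def by (rule set_eqI) (simp only: UN_iff mem_Collect_eq Bex_def mem_Times_iff split_paired_Ex fst_conv snd_conv, blast)
    moreover have "finite {X \<in> Pow L \<times> Pow R. card L \<le> 2 * card (fst X) \<and> card R < 2 * card (snd X)}"
      using L(1) R(1) by simp
    ultimately show ?thesis
      by (simp only:) (rule closed_UN; simp add: *)
  qed
  moreover have "UNIV \<subseteq> U \<union> V"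
  proof
    fix t
    obtain a where a: "a \<in> L" "card L < 2 * card {x \<in> L. h t x \<le> h t a}"
        "card L \<le> 2 * card {x \<in> L. h t a \<le> h t x}"
      using median_exists[OF L(1,2), of "h t"] by blast
    obtain b where b: "b \<in> R" "card R < 2 * card {x \<in> R. h t x \<le> h t b}"
        "card R \<le> 2 * card {x \<in> R. h t b \<le> h t x}"
      using median_exists[OF R(1,2), of "h t"] by blast
    show "t \<in> U \<union> V"
    proof (cases "h t a \<le> h t b")
      case True
      then have "t \<in> U"
        unfolding U_def using a b
        by (intro CollectI bexI[of _ "{x \<in> L. h t x \<le> h t a}"] bexI[of _ "{x \<in> R. h t b \<le> h t x}"]) auto
      then show ?thesis ..
    next
      case False
      then have "t \<in> V"
        unfolding V_def using a b
        by (intro CollectI bexI[of _ "{x \<in> L. h t a \<le> h t x}"] bexI[of _ "{x \<in> R. h t x \<le> h t b}"]) auto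
      then show ?thesis ..
    qed
  qed
  moreover have "U \<inter> UNIV \<noteq> {}" "V \<inter> UNIV \<noteq> {}"
  proof -
    \<comment> \<open>The slopes of all segments from \<open>L\<close> to \<open>R\<close>. As
      \<open>q\<close> lies to the right of \<open>p\<close>, \<open>h t p \<le> h t q\<close> says
      that \<open>t\<close> is at most the slope of \<open>p q\<close>; so the least slope is in
      \<open>U\<close> and the greatest in \<open>V\<close>.\<close>
    define M where "M = (\<lambda>(p, q). (q $ 2 - p $ 2) / (q $ 1 - p $ 1)) ` (L \<times> R)"
    have M: "finite M" "M \<noteq> {}"
      using L R by (auto simp: M_def)
    have slope: "(q $ 2 - p $ 2) / (q $ 1 - p $ 1) \<in> M" if "p \<in> L" "q \<in> R" for p q
      using that by (force simp: M_def)
    have pos: "0 < q $ 1 - p $ 1" if "p \<in> L" "q \<in> R" for p q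
      using L(3)[OF that(1)] R(3)[OF that(2)] by simp
    have "h (Min M) p \<le> h (Min M) q" if "p \<in> L" "q \<in> R" for p q
      using Min_le[OF M(1) slope[OF that]] pos[OF that] by (simp add: h_def field_simps)
    then have "Min M \<in> U"
      unfolding U_def using L R by (intro CollectI bexI[of _ L] bexI[of _ R]) (auto simp: card_gt_0_iff)
    moreover have "h (Max M) q \<le> h (Max M) p" if "p \<in> L" "q \<in> R" for p q
      using Max_ge[OF M(1) slope[OF that]] pos[OF that] by (simp add: h_def field_simps)
    then have "Max M \<in> V"
      unfolding V_def using L R by (intro CollectI bexI[of _ L] bexI[of _ R]) (auto simp: card_gt_0_iff)
    ultimately show "U \<inter> UNIV \<noteq> {}" "V \<inter> UNIV \<noteq> {}"
      by auto
  qed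
  ultimately obtain t where "t \<in> U" "t \<in> V"
    using connected_UNIV[where 'a=real] unfolding connected_closed by blast
  obtain A B where A: "A \<subseteq> L" "B \<subseteq> R" "card L < 2 * card A" "card R \<le> 2 * card B"
      "\<And>p q. p \<in> A \<Longrightarrow> q \<in> B \<Longrightarrow> h t p \<le> h t q"
    using \<open>t \<in> U\<close> unfolding U_def by auto
  obtain A' B' where A': "A' \<subseteq> L" "B' \<subseteq> R" "card L \<le> 2 * card A'" "card R < 2 * card B'"
      "\<And>p q. p \<in> A' \<Longrightarrow> q \<in> B' \<Longrightarrow> h t q \<le> h t p"
    using \<open>t \<in> V\<close> unfolding V_def by auto
  have "A \<inter> A' \<noteq> {}" "B \<inter> B' \<noteq> {}"
    using A A' L(1) R(1)
    by (intro inter_nonempty_of_card[of L] inter_nonempty_of_card[of R]; simp)+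
  then obtain a b where ab: "a \<in> A" "a \<in> A'" "b \<in> B" "b \<in> B'"
    by blast
  \<comment> \<open>The common points pin down the level: all of \<open>A\<close> and
    \<open>B'\<close> lies at or below it, all of \<open>B\<close> and \<open>A'\<close> at or above
    it.\<close>
  have eq: "h t a = h t b"
    using A(5)[OF ab(1,3)] A'(5)[OF ab(2,4)] by simp
  have "card A \<le> card {p \<in> L. h t p \<le> h t b}" "card A' \<le> card {p \<in> L. h t b \<le> h t p}"
    by (use A(1,5) A'(1,5) ab L(1) in \<open>auto intro!: card_mono\<close>)
  moreover have "card B' \<le> card {p \<in> R. h t p \<le> h t b}" "card B \<le> card {p \<in> R. h t b \<le> h t p}"
    unfolding eq[symmetric] by (use A(2,5) A'(2,5) ab R(1) in \<open>auto intro!: card_mono\<close>)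
  ultimately show ?thesis
    using A A' by (intro exI[of _ t] exI[of _ "h t b"]) (auto simp: h_def)
qed

section \<open>Directions and angles at a point\<close>

text \<open>The planar cross product: for nonzero \<open>a\<close> it vanishes exactly on the
  multiples of \<open>a\<close>, and its sign tells on which side of \<open>a\<close> the vector
  \<open>b\<close> lies.\<close>

definition det2 :: "real ^ 2 \<Rightarrow> real ^ 2 \<Rightarrow> real" where
  "det2 a b = a $ 1 * b $ 2 - a $ 2 * b $ 1"

lemma det2_eq_0_imp_scaleR:
  assumes "det2 a b = 0" "a \<noteq> 0"
  obtains k where "b = k *\<^sub>R a"
proof (cases "a $ 1 = 0")
  case True
  then have "a $ 2 \<noteq> 0" "b $ 1 = 0"
    using assms by (auto simp: det2_def vec_eq_iff forall_2)
  then show ?thesis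
    using True that[of "b $ 2 / a $ 2"] by (simp add: vec_eq_iff forall_2)
next
  case False
  then show ?thesis
    using assms that[of "b $ 1 / a $ 1"] by (simp add: det2_def vec_eq_iff forall_2 field_simps)
qed

text \<open>Lagrange's identity, that is, cosine squared plus sine squared equals one.\<close>

lemma inner_sq_plus_det2_sq: "(a \<bullet> b)\<^sup>2 + (det2 a b)\<^sup>2 = (norm a)\<^sup>2 * (norm b)\<^sup>2"
  unfolding power2_norm_eq_inner
  by (simp add: det2_def inner_vec_def sum_2 power2_eq_square algebra_simps)

text \<open>Up to the factor \<open>norm a\<close>, the numbers \<open>a \<bullet> x\<close> and
  \<open>det2 a x\<close> are the coordinates of \<open>x\<close> in the orthonormal frame along
  \<open>a\<close>; the right side is the determinant in these coordinates.\<close>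

lemma norm_sq_mult_det2: "(norm a)\<^sup>2 * det2 x y = (a \<bullet> x) * det2 a y - (a \<bullet> y) * det2 a x"
  unfolding power2_norm_eq_inner
  by (simp add: det2_def inner_vec_def sum_2 algebra_simps)

text \<open>The cosine fixes the absolute value of the sine by Lagrange's identity and the side
  fixes its sign, so \<open>x\<close> and \<open>y\<close> point in the same direction relative to
  \<open>a\<close>.\<close>

lemma same_angle_same_side_imp_det2_eq_0:
  assumes "a \<noteq> 0" "x \<noteq> 0" "y \<noteq> 0"
    and angle: "(a \<bullet> x) / (norm a * norm x) = (a \<bullet> y) / (norm a * norm y)"
    and side: "0 < det2 a x \<longleftrightarrow> 0 < det2 a y"
  shows "det2 x y = 0"
proof -
  define c where "c = (a \<bullet> x) / (norm a * norm x)"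
  have ip: "a \<bullet> x = c * (norm a * norm x)" "a \<bullet> y = c * (norm a * norm y)"
    using assms by (auto simp: c_def field_simps)
  have dsq: "(det2 a z)\<^sup>2 = (1 - c\<^sup>2) * (norm a * norm z)\<^sup>2" if "a \<bullet> z = c * (norm a * norm z)" for z
    using inner_sq_plus_det2_sq[of a z] that by (simp add: power_mult_distrib algebra_simps)
  have abs: "\<bar>det2 a z\<bar> = sqrt (1 - c\<^sup>2) * (norm a * norm z)" if "a \<bullet> z = c * (norm a * norm z)" for z
    using dsq[OF that] by (metis (no_types, lifting) abs_mult abs_norm_cancel real_sqrt_abs real_sqrt_mult)
  \<comment> \<open>If \<open>0 < det2 a x\<close> fails, the determinant is minus its absolute
    value, also when it is zero.\<close>
  define s where "s = (if 0 < det2 a x then 1 else - 1) * sqrt (1 - c\<^sup>2)"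
  have "det2 a x = s * (norm a * norm x)" "det2 a y = s * (norm a * norm y)"
    using abs[OF ip(1)] abs[OF ip(2)] side by (auto simp: s_def split: if_splits)
  then have "(norm a)\<^sup>2 * det2 x y = 0"
    unfolding norm_sq_mult_det2 ip by simp
  then show ?thesis
    using assms by simp
qed

text \<open>Seen from a fixed \<open>q\<close> in \<open>S\<close>, every other \<open>r\<close> is
  determined by its angle and its side. This injects \<open>S - {q}\<close> into two copies of the
  set of angles; \<open>q\<close> itself accounts for the \<open>+ 1\<close>.\<close>

lemma card_directions_le_angle_count:
  assumes P: "finite P" and S: "S \<subseteq> P - {p}"
    and dir: "\<And>q r. q \<in> S \<Longrightarrow> r \<in> S \<Longrightarrow> q \<noteq> r \<Longrightarrow> det2 (q - p) (r - p) \<noteq> 0"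
  shows "card S \<le> 2 * angle_count P p + 1"
proof (cases "S = {}")
  case False
  then obtain q where q: "q \<in> S" by blast
  have finS: "finite S"
    using S P finite_subset by blast
  define T where "T = {angle_at q p r | q r. q \<in> P - {p} \<and> r \<in> P - {p} \<and> q \<noteq> r} \<inter> {0<..<pi}"
  have "finite ((\<lambda>(q, r). angle_at q p r) ` (P \<times> P))"
    using P by simp
  moreover have "T \<subseteq> (\<lambda>(q, r). angle_at q p r) ` (P \<times> P)"
    by (auto simp: T_def)
  ultimately have finT: "finite T"
    by (rule finite_subset[rotated])
  define g where "g r = (angle_at q p r, 0 < det2 (q - p) (r - p))" for r
  define cosine where "cosine r = ((q - p) \<bullet> (r - p)) / (norm (q - p) * norm (r - p))" for r
  have angle_eq: "angle_at q p r = arccos (cosine r)" for r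
    by (simp add: angle_at_def cosine_def)
  \<comment> \<open>Independent vectors make Cauchy-Schwarz strict: the angle lies in the open
    interval, and \<open>arccos\<close> is injective on these values.\<close>
  have bd: "\<bar>cosine r\<bar> < 1" if "r \<in> S - {q}" for r
  proof -
    have "q - p \<noteq> 0" "r - p \<noteq> 0" "det2 (q - p) (r - p) \<noteq> 0"
      using that q S dir by auto
    then have "0 < (det2 (q - p) (r - p))\<^sup>2"
      by simp
    then have "((q - p) \<bullet> (r - p))\<^sup>2 < (norm (q - p) * norm (r - p))\<^sup>2"
      using inner_sq_plus_det2_sq[of "q - p" "r - p"] unfolding power_mult_distrib by linarith
    then have "\<bar>(q - p) \<bullet> (r - p)\<bar> < norm (q - p) * norm (r - p)"
      using power2_less_imp_less[of "\<bar>(q - p) \<bullet> (r - p)\<bar>" "norm (q - p) * norm (r - p)"]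
      unfolding power2_abs by (metis mult_nonneg_nonneg norm_ge_zero)
    then show ?thesis
      using \<open>q - p \<noteq> 0\<close> \<open>r - p \<noteq> 0\<close> unfolding cosine_def abs_divide
      by (metis abs_ge_zero abs_of_nonneg divide_less_eq_1_pos le_less_trans order_less_imp_le)
  qed
  have "g ` (S - {q}) \<subseteq> T \<times> UNIV"
  proof
    fix z assume "z \<in> g ` (S - {q})"
    then obtain r where r: "r \<in> S - {q}" "z = g r" by blast
    have "angle_at q p r \<in> {0<..<pi}"
      using bd[OF r(1)] arccos_lt_bounded[of "cosine r"] by (auto simp: angle_eq)
    moreover have "angle_at q p r \<in> {angle_at q p r | q r. q \<in> P - {p} \<and> r \<in> P - {p} \<and> q \<noteq> r}"
      using r(1) q S by blast
    ultimately show "z \<in> T \<times> UNIV"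
      by (simp add: r(2) g_def T_def)
  qed
  moreover have "inj_on g (S - {q})"
  proof (rule inj_onI)
    fix r r' assume r: "r \<in> S - {q}" "r' \<in> S - {q}" "g r = g r'"
    have "arccos (cosine r) = arccos (cosine r')"
      using r(3) by (simp add: g_def angle_eq)
    then have "cosine r = cosine r'"
      using bd[OF r(1)] bd[OF r(2)] by (simp add: arccos_eq_iff)
    then have "det2 (r - p) (r' - p) = 0"
      using r q S by (intro same_angle_same_side_imp_det2_eq_0[of "q - p"]) (auto simp: g_def cosine_def)
    then show "r = r'"
      using dir r by blast
  qed
  ultimately have "card (S - {q}) \<le> card (T \<times> (UNIV :: bool set))"
    using finT by (intro card_inj_on_le) auto
  then show ?thesis
    using q finS by (simp add: angle_count_def T_def card_cartesian_product)
qed simp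

section \<open>Lines spanned by a finite point set\<close>

text \<open>Lines are represented by their traces on \<open>Q\<close>, so that a finite
  \<open>Q\<close> has finitely many and they can serve as blocks. Only \<open>p \<noteq> q\<close>
  gives a line; for \<open>p = q\<close> the trace is all of \<open>Q\<close>.\<close>

definition line_in :: "(real ^ 2) set \<Rightarrow> real ^ 2 \<Rightarrow> real ^ 2 \<Rightarrow> (real ^ 2) set" where
  "line_in Q p q = {r \<in> Q. det2 (q - p) (r - p) = 0}"

definition lines_in :: "(real ^ 2) set \<Rightarrow> (real ^ 2) set set" where
  "lines_in Q = {line_in Q p q | p q. p \<in> Q \<and> q \<in> Q \<and> p \<noteq> q}"

text \<open>If \<open>p\<close> and \<open>q\<close> have parameters \<open>k\<close> and
  \<open>l\<close> on the line through \<open>a\<close> and \<open>b\<close>, changing the base pair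
  multiplies the determinant by \<open>l - k\<close>, which is nonzero.\<close>

lemma line_in_eqI:
  assumes "p \<in> line_in Q a b" "q \<in> line_in Q a b" "p \<noteq> q" "a \<noteq> b"
  shows "line_in Q a b = line_in Q p q"
proof -
  have "det2 (b - a) (p - a) = 0" "det2 (b - a) (q - a) = 0" "b - a \<noteq> 0"
    using assms by (auto simp: line_in_def)
  then obtain k l where k: "p - a = k *\<^sub>R (b - a)" and l: "q - a = l *\<^sub>R (b - a)"
    by (meson det2_eq_0_imp_scaleR)
  have "k \<noteq> l"
    using k l assms(3) by (metis diff_add_cancel)
  have p: "p = a + k *\<^sub>R (b - a)" and q: "q = a + l *\<^sub>R (b - a)"
    using k l by (auto simp: algebra_simps)
  have "det2 (q - p) (r - p) = (l - k) * det2 (b - a) (r - a)" for r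
    by (simp add: det2_def p q algebra_simps)
  then show ?thesis
    using \<open>k \<noteq> l\<close> by (auto simp: line_in_def)
qed

lemma lines_in_eq_line_in:
  assumes "l \<in> lines_in Q" "p \<in> l" "q \<in> l" "p \<noteq> q"
  shows "l = line_in Q p q"
proof -
  obtain a b where l: "l = line_in Q a b" "a \<noteq> b"
    using assms(1) by (auto simp: lines_in_def)
  show ?thesis
    unfolding l(1) by (rule line_in_eqI) (use assms(2-4) l in simp_all)
qed

lemma endpoints_in_line_in: "p \<in> Q \<Longrightarrow> p \<in> line_in Q p q" "q \<in> Q \<Longrightarrow> q \<in> line_in Q p q"
  by (auto simp: line_in_def det2_def)

lemma card_lines_through_two_points:
  assumes "p \<in> Q" "q \<in> Q" "p \<noteq> q"
  shows "card {l \<in> lines_in Q. p \<in> l \<and> q \<in> l} = 1"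
proof -
  have "{l \<in> lines_in Q. p \<in> l \<and> q \<in> l} = {line_in Q p q}"
    using lines_in_eq_line_in[of _ Q p q] assms endpoints_in_line_in[of _ Q]
    by (auto simp: lines_in_def)
  then show ?thesis by simp
qed

lemma lines_in_subset_hyperplane:
  assumes "l \<in> lines_in Q"
  obtains v c where "v \<noteq> 0" "l \<subseteq> {r. v \<bullet> r = c}"
proof -
  obtain p q where pq: "p \<noteq> q" "l = line_in Q p q"
    using assms by (auto simp: lines_in_def)
  \<comment> \<open>The direction \<open>q - p\<close> turned by a right angle, a normal vector of
    the line.\<close>
  define v :: "real ^ 2" where "v = vector [- (q - p) $ 2, (q - p) $ 1]"
  have v: "v \<noteq> 0"
    using pq by (auto simp: v_def vec_eq_iff forall_2)
  have diff: "v \<bullet> r - v \<bullet> p = det2 (q - p) (r - p)" for r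
    by (simp add: v_def inner_vec_def sum_2 det2_def algebra_simps)
  have "v \<bullet> r = v \<bullet> p" if "r \<in> l" for r
    using diff[of r] that by (simp add: pq line_in_def)
  with v show ?thesis
    using that by blast
qed

text \<open>A second point is chosen on each line through \<open>p\<close>. Two such points in
  parallel directions from \<open>p\<close> would lie on one line, so different lines give
  independent directions.\<close>

lemma card_lines_through_point_le_angle_count:
  assumes P: "finite P" and Q: "Q \<subseteq> P" "p \<in> Q"
  shows "card {l \<in> lines_in Q. p \<in> l} \<le> 2 * angle_count P p + 1"
proof -
  define Lp where "Lp = {l \<in> lines_in Q. p \<in> l}"
  have "\<exists>q. q \<in> l \<and> q \<noteq> p" if "l \<in> Lp" for l
    using that endpoints_in_line_in[of _ Q] by (auto simp: Lp_def lines_in_def) metis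
  then obtain g where g: "\<And>l. l \<in> Lp \<Longrightarrow> g l \<in> l" "\<And>l. l \<in> Lp \<Longrightarrow> g l \<noteq> p"
    by metis
  have l_eq: "l = line_in Q p (g l)" if "l \<in> Lp" for l
    using that g[OF that] by (intro lines_in_eq_line_in) (auto simp: Lp_def)
  have gQ: "g l \<in> Q" if "l \<in> Lp" for l
    using g(1)[OF that] l_eq[OF that] by (auto simp: line_in_def)
  have "inj_on g Lp"
    using l_eq by (metis inj_onI)
  then have "card Lp = card (g ` Lp)"
    by (simp add: card_image)
  also have "\<dots> \<le> 2 * angle_count P p + 1"
  proof (rule card_directions_le_angle_count[OF P])
    show "g ` Lp \<subseteq> P - {p}"
      using gQ g Q by blast
    fix q r assume "q \<in> g ` Lp" "r \<in> g ` Lp" "q \<noteq> r"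
    then obtain l l' where l: "l \<in> Lp" "l' \<in> Lp" "q = g l" "r = g l'" "l \<noteq> l'"
      by blast
    show "det2 (q - p) (r - p) \<noteq> 0"
    proof
      assume "det2 (q - p) (r - p) = 0"
      then have "r \<in> l"
        using l gQ l_eq[OF l(1)] by (auto simp: line_in_def)
      then have "l = line_in Q p r"
        using l g by (intro lines_in_eq_line_in) (auto simp: Lp_def)
      then show False
        using l l_eq by simp
    qed
  qed
  finally show ?thesis
    by (simp add: Lp_def)
qed

section \<open>Many points on one line\<close>

lemma collinear_hyperplane:
  fixes v :: "real ^ 2"
  assumes "v \<noteq> 0" "P \<subseteq> {p. v \<bullet> p = c}"
  shows "collinear P"
  unfolding collinear_def
proof (intro exI[of _ "vector [- v $ 2, v $ 1]"] ballI)
  fix x y assume "x \<in> P" "y \<in> P"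
  then have "v \<bullet> x = v \<bullet> y"
    using assms by (auto simp: subset_iff)
  then have "det2 (vector [- v $ 2, v $ 1]) (x - y) = 0"
    by (simp add: det2_def inner_vec_def sum_2 algebra_simps)
  moreover have "(vector [- v $ 2, v $ 1] :: real ^ 2) \<noteq> 0"
    using assms by (auto simp: vec_eq_iff forall_2)
  ultimately show "\<exists>c. x - y = c *\<^sub>R vector [- v $ 2, v $ 1]"
    using det2_eq_0_imp_scaleR by blast
qed

text \<open>From a point off the line, distinct points of the line are seen in independent
  directions: \<open>r - p = k *\<^sub>R (q - p)\<close> forces \<open>k = 1\<close> after taking
  the inner product with \<open>v\<close>.\<close>

lemma card_hyperplane_le_angle_count:
  fixes v :: "real ^ 2"
  assumes P: "finite P" "p \<in> P" "v \<bullet> p \<noteq> c"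
  shows "card {q \<in> P. v \<bullet> q = c} \<le> 2 * angle_count P p + 1"
proof (rule card_directions_le_angle_count[OF P(1)])
  show "{q \<in> P. v \<bullet> q = c} \<subseteq> P - {p}"
    using P by auto
  fix q r assume q: "q \<in> {q \<in> P. v \<bullet> q = c}" and r: "r \<in> {q \<in> P. v \<bullet> q = c}" and "q \<noteq> r"
  show "det2 (q - p) (r - p) \<noteq> 0"
  proof
    assume "det2 (q - p) (r - p) = 0"
    moreover have "q - p \<noteq> 0"
      using P q by auto
    ultimately obtain k where k: "r - p = k *\<^sub>R (q - p)"
      using det2_eq_0_imp_scaleR by blast
    have "v \<bullet> (r - p) = k * (v \<bullet> (q - p))"
      unfolding k by simp
    then have "k = 1"
      using P q r by (simp add: inner_diff_right)
    then show False
      using k \<open>q \<noteq> r\<close> by simp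
  qed
qed

section \<open>Lower bound\<close>

text \<open>Indices of the four parts: one sign for each of the two dividing lines.\<close>

definition signs :: "(real \<times> real) set" where
  "signs = {1, - 1} \<times> {1, - 1}"

lemma finite_signs: "finite signs" and card_signs: "card signs = 4"
  by (simp_all add: signs_def card_cartesian_product)

text \<open>No line meets all four open quadrants: the linear form is positive in the quadrant whose
  signs match those of \<open>a\<close> and \<open>b\<close> and negative in the opposite one, so it
  cannot equal \<open>c\<close> in both.\<close>

lemma sign_pattern_not_on_line:
  fixes X Y :: "real \<times> real \<Rightarrow> real"
  assumes "(a, b) \<noteq> (0, 0)"
    and "\<And>s t. s \<in> {1, - 1} \<Longrightarrow> t \<in> {1, - 1} \<Longrightarrow> 0 < s * X (s, t) \<and> 0 < t * Y (s, t)"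
    and on: "\<And>s t. s \<in> {1, - 1} \<Longrightarrow> t \<in> {1, - 1} \<Longrightarrow> a * X (s, t) + b * Y (s, t) = c"
  shows False
proof -
  define s where "s = (if 0 \<le> a then 1 else - 1 :: real)"
  define t where "t = (if 0 \<le> b then 1 else - 1 :: real)"
  have st: "s \<in> {1, - 1}" "t \<in> {1, - 1}" "- s \<in> {1, - 1}" "- t \<in> {1, - 1}"
    by (auto simp: s_def t_def)
  have a: "a = \<bar>a\<bar> * s" and b: "b = \<bar>b\<bar> * t"
    by (auto simp: s_def t_def)
  have pos: "0 < s * X (s, t)" "0 < t * Y (s, t)" "0 < - s * X (- s, - t)" "0 < - t * Y (- s, - t)"
    using assms(2)[OF st(1,2)] assms(2)[OF st(3,4)] by auto
  have ab: "0 < \<bar>a\<bar> \<or> 0 < \<bar>b\<bar>"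
    using assms(1) by auto
  have "0 < \<bar>a\<bar> * (s * X (s, t)) + \<bar>b\<bar> * (t * Y (s, t))"
    using pos ab by (metis abs_ge_zero add_nonneg_pos add_pos_nonneg less_imp_le mult_nonneg_nonneg mult_pos_pos)
  moreover have "0 < \<bar>a\<bar> * (- s * X (- s, - t)) + \<bar>b\<bar> * (- t * Y (- s, - t))"
    using pos ab by (metis abs_ge_zero add_nonneg_pos add_pos_nonneg less_imp_le mult_nonneg_nonneg mult_pos_pos)
  ultimately have "0 < a * X (s, t) + b * Y (s, t)" "a * X (- s, - t) + b * Y (- s, - t) < 0"
    by (subst a, subst b, simp add: algebra_simps)+
  then show False
    using on[OF st(1,2)] on[OF st(3,4)] by simp
qed

text \<open>A vertical median line splits \<open>P\<close> into \<open>L\<close> and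
  \<open>R\<close>, and a second line bisects both. Each halving loses at most the \<open>e\<close>
  points on the dividing line, so \<open>card P \<le> 2 * card L + 2 * e\<close> and a further
  halving give the \<open>6 * e\<close>.\<close>

lemma four_parts_missed_by_lines:
  fixes P :: "(real ^ 2) set"
  assumes P: "finite P" and lines: "\<And>v c. v \<noteq> 0 \<Longrightarrow> card {p \<in> P. v \<bullet> p = c} \<le> e"
    and e: "2 * e < card P"
  obtains C :: "real \<times> real \<Rightarrow> (real ^ 2) set"
  where "disjoint_family_on C signs" "\<And>i. i \<in> signs \<Longrightarrow> C i \<subseteq> P"
    "\<And>i. i \<in> signs \<Longrightarrow> card P \<le> 4 * card (C i) + 6 * e"
    "\<And>v c. v \<noteq> 0 \<Longrightarrow> \<exists>i\<in>signs. {p. v \<bullet> p = c} \<inter> C i = {}"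
proof -
  have le_card: "card {p \<in> S. f p \<le> u} \<le> card {p \<in> S. f p < u} + e" 
       "card {p \<in> S. u \<le> f p} \<le> card {p \<in> S. u < f p} + e"
    if "S \<subseteq> P" "v \<noteq> 0" "\<And>p. f p = v \<bullet> p" for S and f :: "real ^ 2 \<Rightarrow> real" and u v
  proof -
    have fin: "finite S"
      using that P finite_subset by blast
    have *: "card {p \<in> S. f p = u} \<le> e"
      using lines[OF that(2), of u] card_mono[of "{p \<in> P. v \<bullet> p = u}" "{p \<in> S. f p = u}"] that P by fastforce
    have "{p \<in> S. f p \<le> u} = {p \<in> S. f p < u} \<union> {p \<in> S. f p = u}"
      "{p \<in> S. u \<le> f p} = {p \<in> S. u < f p} \<union> {p \<in> S. f p = u}"
      by auto
    then show "card {p \<in> S. f p \<le> u} \<le> card {p \<in> S. f p < u} + e" 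
       "card {p \<in> S. u \<le> f p} \<le> card {p \<in> S. u < f p} + e"
      using card_Un_le[of "{p \<in> S. f p < u}" "{p \<in> S. f p = u}"]
        card_Un_le[of "{p \<in> S. u < f p}" "{p \<in> S. f p = u}"] * by auto
  qed
  have "P \<noteq> {}"
    using e by auto
  from median_exists[OF P this, of "\<lambda>p. p $ 1"] obtain a :: "real ^ 2" where
    a: "card P < 2 * card {p \<in> P. p $ 1 \<le> a $ 1}" "card P \<le> 2 * card {p \<in> P. a $ 1 \<le> p $ 1}"
    by auto
  define c where "c = a $ 1"
  define L where "L = {p \<in> P. p $ 1 < c}"
  define R where "R = {p \<in> P. c < p $ 1}"
  have x: "p $ 1 = axis 1 1 \<bullet> p" for p :: "real ^ 2"
    by (simp add: inner_axis')
  have "(axis 1 1 :: real ^ 2) \<noteq> 0"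
    by simp
  note bound = le_card[OF subset_refl this x, of c]
  have card_LR: "card P \<le> 2 * card L + 2 * e" "card P \<le> 2 * card R + 2 * e"
    using a bound unfolding L_def R_def c_def by linarith+
  have "L \<noteq> {}" "R \<noteq> {}"
    using card_LR e by auto
  moreover have "finite L" "finite R" "L \<subseteq> P" "R \<subseteq> P"
    using P by (auto simp: L_def R_def)
  ultimately have LR: "finite L" "finite R" "L \<subseteq> P" "R \<subseteq> P" "L \<noteq> {}" "R \<noteq> {}"
    by auto
  obtain t u where tu: "\<And>S. S \<in> {L, R} \<Longrightarrow> card S \<le> 2 * card {p \<in> S. p $ 2 - t * p $ 1 \<le> u} \<and>
                            card S \<le> 2 * card {p \<in> S. u \<le> p $ 2 - t * p $ 1}"
    using ham_sandwich_separated[of L c R] LR unfolding L_def R_def by blast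
  define h where "h p = p $ 2 - t * p $ 1" for p :: "real ^ 2"
  have h: "h p = vector [- t, 1] \<bullet> p" for p
    by (simp add: h_def inner_vec_def sum_2)
  have nz: "(vector [- t, 1] :: real ^ 2) \<noteq> 0"
    by (auto simp: vec_eq_iff forall_2)
  define C where "C = (\<lambda>(s, s'). {p \<in> P. 0 < s * (p $ 1 - c) \<and> 0 < s' * (h p - u)})"
  have C_eq: "C (1, 1) = {p \<in> R. u < h p}" "C (1, - 1) = {p \<in> R. h p < u}"
    "C (- 1, 1) = {p \<in> L. u < h p}" "C (- 1, - 1) = {p \<in> L. h p < u}"
    by (auto simp: C_def L_def R_def)
  have half: "card S \<le> 2 * card {p \<in> S. h p < u} + 2 * e" "card S \<le> 2 * card {p \<in> S. u < h p} + 2 * e"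
    if "S \<in> {L, R}" for S
    using tu[OF that] le_card[OF _ nz h, of S u] that LR by (auto simp: h_def)
  show ?thesis
  proof
    show "disjoint_family_on C signs"
      by (auto simp: disjoint_family_on_def signs_def C_def)
    show "C i \<subseteq> P" for i
      by (auto simp: C_def split: prod.splits)
    show "card P \<le> 4 * card (C i) + 6 * e" if "i \<in> signs" for i
      using that half[of L] half[of R] card_LR by (auto simp: signs_def C_eq)
    show "\<exists>i\<in>signs. {p. v \<bullet> p = w} \<inter> C i = {}" if v: "v \<noteq> 0" for v w
    proof (rule ccontr)
      assume "\<not> ?thesis"
      then have "\<forall>i\<in>signs. \<exists>p. v \<bullet> p = w \<and> p \<in> C i"
        by blast
      then obtain p where p: "\<And>i. i \<in> signs \<Longrightarrow> v \<bullet> p i = w" "\<And>i. i \<in> signs \<Longrightarrow> p i \<in> C i"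
        by metis
      \<comment> \<open>In the affine coordinates \<open>p $ 1 - c\<close> and
        \<open>h p - u\<close> the parts lie in the four open quadrants; \<open>a\<close> and
        \<open>v $ 2\<close> are the coefficients of the given line in these coordinates.\<close>
      define a where "a = v $ 1 + t * v $ 2"
      show False
      proof (rule sign_pattern_not_on_line[of a "v $ 2" "\<lambda>i. p i $ 1 - c" "\<lambda>i. h (p i) - u" "w - a * c - v $ 2 * u"])
        show "(a, v $ 2) \<noteq> (0, 0)"
          using v by (auto simp: a_def vec_eq_iff forall_2)
        fix s t' :: real assume "s \<in> {1, - 1}" "t' \<in> {1, - 1}"
        then have st: "(s, t') \<in> signs"
          by (auto simp: signs_def)
        show "0 < s * (p (s, t') $ 1 - c) \<and> 0 < t' * (h (p (s, t')) - u)"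
          using p(2)[OF st] by (simp add: C_def)
        show "a * (p (s, t') $ 1 - c) + v $ 2 * (h (p (s, t')) - u) = w - a * c - v $ 2 * u"
          unfolding p(1)[OF st, symmetric] by (simp add: a_def h_def inner_vec_def sum_2 algebra_simps)
      qed
    qed
  qed
qed

lemma exists_point_with_many_angles:
  assumes P: "finite P" "\<not> collinear P" and n: "8 \<le> card P"
  shows "\<exists>p\<in>P. card P \<le> 32 * angle_count P p + 22"
proof -
  \<comment> \<open>With this threshold \<open>6 * e\<close> is at most half of
    \<open>card P\<close>, so in the case without a rich line each part keeps about an eighth of the
    points.\<close>
  define e where "e = card P div 12"
  show ?thesis
  proof (cases "\<exists>v c. v \<noteq> 0 \<and> e < card {p \<in> P. v \<bullet> p = c}")
    case True
    then obtain v c where v: "v \<noteq> 0" "e < card {p \<in> P. v \<bullet> p = c}"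
      by blast
    obtain p where p: "p \<in> P" "v \<bullet> p \<noteq> c"
      using collinear_hyperplane[OF v(1), of P c] P by auto
    have "e < 2 * angle_count P p + 1"
      using card_hyperplane_le_angle_count[OF P(1) p] v by simp
    then show ?thesis
      using p by (intro bexI[of _ p]) (auto simp: e_def)
  next
    case False
    have e: "2 * e < card P" "12 * e \<le> card P"
      using n by (auto simp: e_def)
    have lines: "card {p \<in> P. v \<bullet> p = c} \<le> e" if "v \<noteq> 0" for v c
      using False that by (meson not_le)
    obtain C where C: "disjoint_family_on C signs" "\<And>i. i \<in> signs \<Longrightarrow> C i \<subseteq> P"
      "\<And>i. i \<in> signs \<Longrightarrow> card P \<le> 4 * card (C i) + 6 * e"
      "\<And>v c. v \<noteq> 0 \<Longrightarrow> \<exists>i\<in>signs. {p. v \<bullet> p = c} \<inter> C i = {}"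
      using four_parts_missed_by_lines[OF P(1) lines e(1)] by blast
    define m where "m = (card P - 6 * e) div 4"
    have m: "0 < m" "card P \<le> 8 * m + 6"
      using n e by (auto simp: m_def)
    \<comment> \<open>The parts are trimmed to a common size, as the block lemma demands; the lines
      are then those spanned by the remaining set \<open>Q\<close>.\<close>
    have "\<exists>D. D \<subseteq> C i \<and> card D = m" if "i \<in> signs" for i
    proof -
      have "m \<le> card (C i)"
        using C(3)[OF that] by (simp add: m_def)
      then show ?thesis
        by (meson obtain_subset_with_card_n)
    qed
    then obtain D where D: "\<And>i. i \<in> signs \<Longrightarrow> D i \<subseteq> C i" "\<And>i. i \<in> signs \<Longrightarrow> card (D i) = m"
      by metis
    define Q where "Q = (\<Union>i\<in>signs. D i)"
    have Q: "Q \<subseteq> P" "finite Q"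
      using D(1) C(2) P(1) finite_subset[of Q P] by (fastforce simp: Q_def)+
    have "\<exists>p\<in>(\<Union>i\<in>signs. D i). m \<le> (card signs - 2) * card {l \<in> lines_in Q. p \<in> l}"
    proof (rule exists_point_in_many_blocks)
      show "finite signs" "2 \<le> card signs"
        by (simp_all add: finite_signs card_signs)
      show "disjoint_family_on D signs"
        using C(1) D(1) unfolding disjoint_family_on_def by blast
      show "finite (D i)" if "i \<in> signs" for i
        using that Q by (auto simp: Q_def intro: finite_subset)
      show "card (D i) = m" if "i \<in> signs" for i
        using D that by simp
      show "0 < m" by fact
      have "lines_in Q \<subseteq> Pow Q"
        by (auto simp: lines_in_def line_in_def)
      then show "finite (lines_in Q)" "\<And>l. l \<in> lines_in Q \<Longrightarrow> l \<subseteq> (\<Union>i\<in>signs. D i)"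
        using Q(2) by (auto simp: Q_def intro: finite_subset)
      show "card {l \<in> lines_in Q. p \<in> l \<and> q \<in> l} = 1"
        if "p \<in> (\<Union>i\<in>signs. D i)" "q \<in> (\<Union>i\<in>signs. D i)" "p \<noteq> q" for p q
        using card_lines_through_two_points that by (simp add: Q_def)
      show "\<exists>i\<in>signs. l \<inter> D i = {}" if l: "l \<in> lines_in Q" for l
      proof -
        obtain v c where "v \<noteq> 0" "l \<subseteq> {p. v \<bullet> p = c}"
          using lines_in_subset_hyperplane[OF l] by blast
        then show ?thesis
          using C(4)[of v c] D(1) by blast
      qed
    qed
    then obtain p where p: "p \<in> Q" "m \<le> 2 * card {l \<in> lines_in Q. p \<in> l}"
      by (auto simp: Q_def card_signs)
    note p(2)
    also have "2 * card {l \<in> lines_in Q. p \<in> l} \<le> 2 * (2 * angle_count P p + 1)"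
      by (intro mult_le_mono2 card_lines_through_point_le_angle_count P Q p)
    finally have "m \<le> 2 * (2 * angle_count P p + 1)" .
    \<comment> \<open>Inserting \<open>m \<le> 4 * angle_count P p + 2\<close> into
      \<open>card P \<le> 8 * m + 6\<close> yields the constants 32 and 22.\<close>
    then show ?thesis
      using p Q m by (intro bexI[of _ p]) auto
  qed
qed

section \<open>Upper bound\<close>

lemma angle_at_commute: "angle_at q p r = angle_at r p q"
  by (simp add: angle_at_def inner_commute mult.commute)

text \<open>The cosine is \<open>sgn s * sgn t\<close>. Such angles are excluded from the count by
  the open interval.\<close>

lemma angle_at_collinear_vertex:
  fixes p w :: "real ^ 2"
  assumes "s \<noteq> 0" "t \<noteq> 0" "w \<noteq> 0"
  shows "angle_at (p + s *\<^sub>R w) p (p + t *\<^sub>R w) \<in> {0, pi}"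
proof -
  have "(s *\<^sub>R w) \<bullet> (t *\<^sub>R w) / (norm (s *\<^sub>R w) * norm (t *\<^sub>R w)) = sgn s * sgn t"
    using assms by (simp add: sgn_real_def dot_square_norm power2_eq_square)
  also have "\<dots> \<in> {1, - 1}"
    using assms by (simp add: sgn_real_def)
  finally show ?thesis
    by (auto simp: angle_at_def)
qed

lemma angle_count_le:
  assumes "finite X" "card X \<le> n"
    and "\<And>q r. q \<in> P - {p} \<Longrightarrow> r \<in> P - {p} \<Longrightarrow> q \<noteq> r \<Longrightarrow> angle_at q p r \<in> X \<union> {0, pi}"
  shows "angle_count P p \<le> n"
proof -
  have "{angle_at q p r | q r. q \<in> P - {p} \<and> r \<in> P - {p} \<and> q \<noteq> r} \<inter> {0<..<pi} \<subseteq> X"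
    using assms(3) by fastforce
  then show ?thesis
    using assms(1,2) card_mono unfolding angle_count_def by (metis (no_types, lifting) le_trans)
qed

text \<open>From the origin, equally spaced directions give only multiples of
  \<open>\<theta>\<close>. From a point on the line, two other points of the line give 0 or
  \<open>pi\<close>, so only pairs containing the origin count, at most one value for each remaining
  point.\<close>

lemma exists_few_angles:
  assumes n: "3 \<le> n"
  shows "\<exists>P. admissible n P \<and> max_angle_count P \<le> n"
proof -
  \<comment> \<open>This keeps \<open>real k * \<theta>\<close> below \<open>pi / 2\<close> for
    \<open>k < n\<close>, where \<open>tan\<close> is strictly increasing and \<open>cos\<close>
    positive.\<close>
  define \<theta> where "\<theta> = pi / (2 * n)"
  define pt where "pt k = (vector [1, tan (real k * \<theta>)] :: real ^ 2)" for k
  define P where "P = insert 0 (pt ` {..<n - 1})"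
  have \<theta>: "0 < \<theta>"
    using n by (simp add: \<theta>_def)
  have small: "- (pi / 2) < real k * \<theta>" "real k * \<theta> < pi / 2" if "k < n" for k
  proof -
    have "0 \<le> real k * \<theta>"
      using \<theta> by simp
    then show "- (pi / 2) < real k * \<theta>"
      using pi_gt_zero by linarith
    have "real k * \<theta> < real n * \<theta>"
      using \<theta> that by simp
    also have "\<dots> = pi / 2"
      using n by (simp add: \<theta>_def)
    finally show "real k * \<theta> < pi / 2" .
  qed
  have tan_less: "tan (real j * \<theta>) < tan (real k * \<theta>)" if "j < k" "k < n" for j k
    using small[of j] small[of k] that \<theta> by (intro tan_monotone mult_strict_right_mono) auto
  have inj_tan: "tan (real j * \<theta>) \<noteq> tan (real k * \<theta>)" if "j \<noteq> k" "j < n" "k < n" for j k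
    using tan_less[of j k] tan_less[of k j] that by (cases j k rule: linorder_cases) auto
  have nz: "pt k \<noteq> 0" for k
    by (simp add: pt_def vec_eq_iff forall_2)
  have inj: "inj_on pt {..<n - 1}"
    using inj_tan by (intro inj_onI) (force simp: pt_def vec_eq_iff forall_2)
  have "finite P"
    by (simp add: P_def)
  moreover have "card P = n"
  proof -
    have "card (pt ` {..<n - 1}) = n - 1"
      using inj by (simp add: card_image)
    moreover have "0 \<notin> pt ` {..<n - 1}"
      using nz by (metis imageE)
    ultimately show ?thesis
      using n by (simp add: P_def)
  qed
  moreover have "\<not> collinear P"
  proof
    assume "collinear P"
    moreover have "{0, pt 0, pt 1} \<subseteq> P"
      using n by (auto simp: P_def)
    ultimately have "collinear {0, pt 0, pt 1}"
      using collinear_subset by blast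
    moreover have "0 < tan \<theta>"
      using tan_less[of 0 1] n by simp
    ultimately show False
      using nz by (auto simp: collinear_lemma pt_def vec_eq_iff forall_2)
  qed
  ultimately have adm: "admissible n P"
    by (simp add: admissible_def)
  have "angle_count P p \<le> n" if p: "p \<in> P" for p
  proof (cases "p = 0")
    case True
    \<comment> \<open>Only the number of values matters, so \<open>arccos (cos _)\<close> is left
      unevaluated; its evenness in the difference is supplied by
      \<open>angle_at_commute\<close>.\<close>
    define X where "X = (\<lambda>d. arccos (cos (real d * \<theta>))) ` {..<n}"
    have angle: "angle_at (pt j) 0 (pt k) = arccos (cos (real j * \<theta> - real k * \<theta>))" if "j < n" "k < n" for j k
    proof -
      have c: "0 < cos (real j * \<theta>)" "0 < cos (real k * \<theta>)"
        using small[OF that(1)] small[OF that(2)] by (auto intro: cos_gt_zero_pi)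
      have pt_scale: "pt i = (1 / cos (real i * \<theta>)) *\<^sub>R vector [cos (real i * \<theta>), sin (real i * \<theta>)]"
        if "0 < cos (real i * \<theta>)" for i
        using that by (simp add: pt_def vec_eq_iff forall_2 tan_def)
      have unit: "norm (vector [cos x, sin x] :: real ^ 2) = 1" for x
        by (simp add: norm_eq_sqrt_inner inner_vec_def sum_2 flip: power2_eq_square)
      have "pt j \<bullet> pt k / (norm (pt j) * norm (pt k)) =
          vector [cos (real j * \<theta>), sin (real j * \<theta>)] \<bullet> (vector [cos (real k * \<theta>), sin (real k * \<theta>)] :: real ^ 2)"
        using c by (simp add: pt_scale unit)
      also have "\<dots> = cos (real j * \<theta> - real k * \<theta>)"
        by (simp add: inner_vec_def sum_2 cos_diff)
      finally show ?thesis
        by (simp add: angle_at_def)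
    qed
    have "angle_at q 0 r \<in> X" if qr: "q \<in> P - {0}" "r \<in> P - {0}" for q r
    proof -
      obtain j k where jk: "q = pt j" "r = pt k" "j < n" "k < n"
        using qr by (auto simp: P_def)
      show ?thesis
      proof (cases "k \<le> j")
        case True
        then have "real j * \<theta> - real k * \<theta> = real (j - k) * \<theta>"
          by (simp add: of_nat_diff algebra_simps)
        then show ?thesis
          using jk angle by (auto simp: X_def)
      next
        case False
        then have "real k * \<theta> - real j * \<theta> = real (k - j) * \<theta>"
          by (simp add: of_nat_diff algebra_simps)
        then show ?thesis
          using jk angle by (subst angle_at_commute) (auto simp: X_def)
      qed
    qed
    moreover have "finite X" "card X \<le> n"
      using card_image_le[of "{..<n}"] by (auto simp: X_def)
    ultimately show ?thesis
      unfolding True by (intro angle_count_le[of X]) auto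
  next
    case False
    then obtain k where k: "p = pt k" "k < n - 1"
      using p by (auto simp: P_def)
    show ?thesis
    proof (rule angle_count_le)
      show "finite (angle_at 0 p ` P)" "card (angle_at 0 p ` P) \<le> n"
        using adm card_image_le[of P] by (auto simp: admissible_def)
      fix q r assume qr: "q \<in> P - {p}" "r \<in> P - {p}" "q \<noteq> r"
      show "angle_at q p r \<in> angle_at 0 p ` P \<union> {0, pi}"
      proof (cases "q = 0 \<or> r = 0")
        case True
        then show ?thesis
        proof
          assume "q = 0"
          then show ?thesis
            using qr by blast
        next
          assume "r = 0"
          then have "angle_at q p r = angle_at 0 p q"
            by (simp add: angle_at_commute)
          then show ?thesis
            using qr by blast
        qed
      next
        case False
        then obtain i j where ij: "q = pt i" "i < n - 1" "i \<noteq> k" "r = pt j" "j < n - 1" "j \<noteq> k"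
          using qr k by (auto simp: P_def)
        have shift: "pt i = p + (tan (real i * \<theta>) - tan (real k * \<theta>)) *\<^sub>R axis 2 1" for i
          by (simp add: k pt_def vec_eq_iff forall_2 axis_def)
        have "angle_at (pt i) p (pt j) \<in> {0, pi}"
          unfolding shift[of i] shift[of j] using ij k inj_tan
          by (intro angle_at_collinear_vertex) auto
        then show ?thesis
          unfolding ij by blast
      qed
    qed
  qed
  then have "max_angle_count P \<le> n"
    unfolding max_angle_count_def using adm by (subst Max_le_iff) (auto simp: admissible_def P_def)
  with adm show ?thesis
    by blast
qed

theorem theorem4p2:
  shows "(\<lambda>n. real (A_hat n)) \<in> \<Theta>(\<lambda>n. real n)"
proof (rule bigthetaI'[of "1 / 64" 1])
  show "\<forall>\<^sub>F n in at_top. 1 / 64 * norm (real n) \<le> norm (real (A_hat n)) \<and>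
      norm (real (A_hat n)) \<le> 1 * norm (real n)"
    \<comment> \<open>For \<open>n \<ge> 44\<close> the additive 22 is at most \<open>n / 2\<close>,
      which turns \<open>n \<le> 32 * angle_count P p + 22\<close> into
      \<open>n \<le> 64 * A_hat n\<close>.\<close>
    using eventually_ge_at_top[of 44]
  proof eventually_elim
    case (elim n)
    obtain P where P: "admissible n P" "A_hat n = max_angle_count P"
      using A_hat_attained[of n] elim by auto
    obtain p where p: "p \<in> P" "n \<le> 32 * angle_count P p + 22"
      using exists_point_with_many_angles[of P] P elim by (auto simp: admissible_def)
    have "angle_count P p \<le> A_hat n"
      using p P by (auto simp: max_angle_count_def admissible_def)
    then have "n \<le> 64 * A_hat n"
      using p elim by linarith
    moreover obtain P' where "admissible n P'" "max_angle_count P' \<le> n"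
      using exists_few_angles[of n] elim by auto
    then have "A_hat n \<le> n"
      using A_hat_le le_trans by blast
    ultimately show ?case
      by simp
  qed
qed simp_all

end
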